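(* Let $ABC$ be a triangle with inradius $r$, let $0<\theta<360^\circ$, and assume that every angle of $\triangle ABC$ is less than $180^\circ-\frac{\theta}{2}$. Let $\gamma_a,\gamma_b,\gamma_c$ be the general triad of circles associated with $\triangle ABC$ and $\theta$. Then the common external tangents to any two of the circles $\gamma_a,\gamma_b,\gamma_c$ all have the same length, and this common length is $2r\tan\frac{\theta}{4}$.
   Context: General triad of circles: $\omega_a$ is the circular arc of angular measure $\theta$ with endpoints $B$ and $C$ erected internally on side $BC$ (i.e. lying on the same side of line $BC$ as $A$); $\omega_b$ (on $CA$) and $\omega_c$ (on $AB$) are defined similarly with the same angular measure $\theta$. $\gamma_a$ is the circle inside $\triangle ABC$, tangent to sides $AB$ and $AC$ and externally tangent to $\omega_a$; $\gamma_b,\gamma_c$ are defined similarly. The assumption that all angles are less than $180^\circ-\theta/2$ is equivalent to the three circles lying inside the triangle. The length of a common external tangent of two circles is the distance between its two points of tangency. *)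

theory Defs
  imports "HOL-Complex_Analysis.Contour_Integration"
begin

text \<open>
  The Euclidean plane is \<^typ>\<open>complex\<close>; angles and angular measures are in radians.
  A circle is given by its centre and its (positive) radius.
\<close>

definition vertex_angle :: "complex \<Rightarrow> complex \<Rightarrow> complex \<Rightarrow> real" where
  "vertex_angle P Q R = arccos (((P - Q) \<bullet> (R - Q)) / (norm (P - Q) * norm (R - Q)))"

definition is_line :: "complex set \<Rightarrow> bool" where
  "is_line L \<longleftrightarrow> affine L \<and> aff_dim L = 1"

definition same_side :: "complex set \<Rightarrow> complex \<Rightarrow> complex \<Rightarrow> bool" where
  "same_side L X Y \<longleftrightarrow> closed_segment X Y \<inter> L = {}"

definition tangent_at :: "complex set \<Rightarrow> complex \<Rightarrow> real \<Rightarrow> complex \<Rightarrow> bool" where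
  "tangent_at L Z \<rho> T \<longleftrightarrow> is_line L \<and> \<rho> > 0 \<and> L \<inter> sphere Z \<rho> = {T}"

text \<open>Tangency to a side of a triangle: the point of contact has to lie on the side itself.\<close>

definition tangent_to_side :: "complex \<Rightarrow> real \<Rightarrow> complex \<Rightarrow> complex \<Rightarrow> bool" where
  "tangent_to_side Z \<rho> P Q \<longleftrightarrow> (\<exists>T\<in>closed_segment P Q. tangent_at (affine hull {P, Q}) Z \<rho> T)"

definition incircle :: "complex \<Rightarrow> complex \<Rightarrow> complex \<Rightarrow> complex \<Rightarrow> real \<Rightarrow> bool" where
  "incircle A B C Z \<rho> \<longleftrightarrow> cball Z \<rho> \<subseteq> convex hull {A, B, C} \<and>
     tangent_to_side Z \<rho> A B \<and> tangent_to_side Z \<rho> B C \<and> tangent_to_side Z \<rho> C A"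

definition externally_tangent_at ::
  "complex \<Rightarrow> real \<Rightarrow> complex \<Rightarrow> real \<Rightarrow> complex \<Rightarrow> bool" where
  "externally_tangent_at Z \<rho> K R T \<longleftrightarrow> \<rho> > 0 \<and> R > 0 \<and>
     sphere Z \<rho> \<inter> sphere K R = {T} \<and> ball Z \<rho> \<inter> ball K R = {}"

text \<open>
  The arc with centre \<open>K\<close> and radius \<open>R\<close> that runs counterclockwise from polar angle
  \<open>\<phi>\<close> to \<open>\<phi> + \<theta>\<close>, and hence has angular measure \<open>\<theta>\<close>, is an arc with endpoints \<open>B\<close> and
  \<open>C\<close> (in either order) erected on \<open>BC\<close> on the same side as \<open>A\<close>.
\<close>

definition erected_arc ::
  "complex \<Rightarrow> complex \<Rightarrow> complex \<Rightarrow> real \<Rightarrow> complex \<Rightarrow> real \<Rightarrow> real \<Rightarrow> bool" where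
  "erected_arc A B C \<theta> K R \<phi> \<longleftrightarrow> R > 0 \<and>
     {pathstart (part_circlepath K R \<phi> (\<phi> + \<theta>)), pathfinish (part_circlepath K R \<phi> (\<phi> + \<theta>))} = {B, C} \<and>
     (\<forall>X \<in> path_image (part_circlepath K R \<phi> (\<phi> + \<theta>)) - {B, C}. same_side (affine hull {B, C}) X A)"

text \<open>
  \<open>triad_circle A B C \<theta> Z \<rho>\<close>: the circle is the member of the general triad that belongs to
  the vertex \<open>A\<close>. The arc on \<open>BC\<close> is unique, so that the existential quantifier just names it;
  the point of contact has to lie on the arc, not merely on the circle carrying it.
\<close>

definition triad_circle ::
  "complex \<Rightarrow> complex \<Rightarrow> complex \<Rightarrow> real \<Rightarrow> complex \<Rightarrow> real \<Rightarrow> bool" where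
  "triad_circle A B C \<theta> Z \<rho> \<longleftrightarrow> cball Z \<rho> \<subseteq> convex hull {A, B, C} \<and>
     tangent_to_side Z \<rho> A B \<and> tangent_to_side Z \<rho> A C \<and>
     (\<exists>K R \<phi>. erected_arc A B C \<theta> K R \<phi> \<and>
        (\<exists>T \<in> path_image (part_circlepath K R \<phi> (\<phi> + \<theta>)). externally_tangent_at Z \<rho> K R T))"

text \<open>
  A common tangent line is external if the two circles lie on the same side of it;
  since it misses both centres, it is enough to say this of the centres.
\<close>

definition common_external_tangent ::
  "complex set \<Rightarrow> complex \<Rightarrow> real \<Rightarrow> complex \<Rightarrow> complex \<Rightarrow> real \<Rightarrow> complex \<Rightarrow> bool" where
  "common_external_tangent L Z\<^sub>1 \<rho>\<^sub>1 P Z\<^sub>2 \<rho>\<^sub>2 Q \<longleftrightarrow>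
     tangent_at L Z\<^sub>1 \<rho>\<^sub>1 P \<and> tangent_at L Z\<^sub>2 \<rho>\<^sub>2 Q \<and> same_side L Z\<^sub>1 Z\<^sub>2"

definition external_tangent_lengths :: "complex \<Rightarrow> real \<Rightarrow> complex \<Rightarrow> real \<Rightarrow> real set" where
  "external_tangent_lengths Z\<^sub>1 \<rho>\<^sub>1 Z\<^sub>2 \<rho>\<^sub>2 =
     {dist P Q | L P Q. common_external_tangent L Z\<^sub>1 \<rho>\<^sub>1 P Z\<^sub>2 \<rho>\<^sub>2 Q}"

end

theory Submission
  imports Defs
begin

text \<open>
  Write \<open>a, b, c\<close> for the sides, \<open>p, q, w\<close> for the lengths of the tangents from \<open>A, B, C\<close> to the
  incircle, and \<open>t = tan (\<theta> / 4)\<close>. The heart of the matter is that \<open>\<gamma>\<^sub>a\<close> touches the sides \<open>AB\<close>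
  and \<open>AC\<close> at distance \<open>x = p - r t\<close> from \<open>A\<close>: each contact point is that of the incircle, moved
  by \<open>r t\<close> towards the vertex. By symmetry \<open>\<gamma>\<^sub>b\<close> touches \<open>BA\<close> at distance \<open>q - r t\<close> from \<open>B\<close>, and
  as \<open>c = p + q\<close>, the contact points of \<open>\<gamma>\<^sub>a\<close> and \<open>\<gamma>\<^sub>b\<close> on \<open>AB\<close> are \<open>2 r t\<close> apart. The line
  \<open>AB\<close> is a common external tangent of these two circles, and the length of any common external
  tangent is determined by the two radii and the distance of the centres
  (\<open>external_tangent_length\<close>), so that \<open>2 r t\<close> is the length of all of them.

  The value of \<open>x\<close> (\<open>triad_circle_contact\<close>) comes from an argument in the manner of Casey's theorem.
  Let the arc \<open>\<omega>\<^sub>a\<close> have radius \<open>R\<close>, let \<open>\<gamma>\<^sub>a\<close> have radius \<open>\<rho>\<close>, and let them touch at \<open>X\<close>. The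
  tangents from \<open>B\<close> and \<open>C\<close> to \<open>\<gamma>\<^sub>a\<close> have lengths \<open>c - x\<close> and \<open>b - x\<close>; they are \<open>BX\<close> and \<open>CX\<close>
  multiplied by the common factor \<open>sqrt (1 + \<rho> / R)\<close> (\<open>externally_tangent_power\<close>). As the arc
  subtends the angle \<open>pi - \<theta> / 2\<close> at \<open>X\<close> and \<open>a = 2 R sin (\<theta> / 2)\<close>, the law of cosines in the
  triangle \<open>BXC\<close> gives
  \<open>a\<^sup>2 + 2 a \<rho> sin (\<theta> / 2) = (c - x)\<^sup>2 + (b - x)\<^sup>2 + 2 (c - x) (b - x) cos (\<theta> / 2)\<close>.
  The incircle and \<open>\<gamma>\<^sub>a\<close> are homothetic from \<open>A\<close>, hence \<open>\<rho> p = r x\<close>, and the equation becomes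
  quadratic in \<open>x\<close>. One root is \<open>p - r t\<close>, and the other one is incompatible with the contact
  points lying on the sides \<open>AB\<close> and \<open>AC\<close> (\<open>contact_distance_equation\<close>).
\<close>

section \<open>Orthogonality and collinearity in the plane\<close>

lemma orthogonal_both_imp_zero:
  fixes N U V :: complex
  assumes "\<not> collinear {0, U, V}" "N \<bullet> U = 0" "N \<bullet> V = 0"
  shows "N = 0"
proof -
  have "\<bar>U \<bullet> V\<bar> \<noteq> norm U * norm V"
    using assms(1) norm_cauchy_schwarz_equal by blast
  then have "(U \<bullet> V)\<^sup>2 \<noteq> (norm U)\<^sup>2 * (norm V)\<^sup>2"
    by (metis abs_ge_zero abs_mult abs_norm_cancel power2_eq_iff_nonneg power_mult_distrib power2_abs)
  \<comment> \<open>The determinant of \<open>U\<close> and \<open>V\<close>: its square is the gap in the Cauchy--Schwarz inequality.\<close>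
  then have cross: "Re U * Im V - Im U * Re V \<noteq> 0"
    unfolding inner_complex_def cmod_power2 by (auto simp: power2_eq_square) algebra
  have 1: "Re N * Re U + Im N * Im U = 0" "Re N * Re V + Im N * Im V = 0"
    using assms(2,3) by (simp_all add: inner_complex_def)
  have "Re N * (Re U * Im V - Im U * Re V) = 0" "Im N * (Re U * Im V - Im U * Re V) = 0"
    using 1 by algebra+
  with cross show ?thesis by (simp add: complex_eq_iff)
qed

lemma orthogonal_imp_multiple_of_normal:
  fixes N D :: complex
  assumes "D \<noteq> 0" "N \<bullet> D = 0"
  obtains s where "N = s *\<^sub>R (\<i> * D)"
proof
  have nz: "(Re D)\<^sup>2 + (Im D)\<^sup>2 \<noteq> 0"
    using assms(1) by (simp add: complex_eq_iff)
  have "Re N * Re D + Im N * Im D = 0"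
    using assms(2) by (simp add: inner_complex_def)
  then have "Re N * ((Re D)\<^sup>2 + (Im D)\<^sup>2) = - ((Im N * Re D - Re N * Im D) * Im D)"
    "Im N * ((Re D)\<^sup>2 + (Im D)\<^sup>2) = (Im N * Re D - Re N * Im D) * Re D"
    by algebra+
  then show "N = ((Im N * Re D - Re N * Im D) / ((Re D)\<^sup>2 + (Im D)\<^sup>2)) *\<^sub>R (\<i> * D)"
    using nz by (simp add: complex_eq_iff divide_simps)
qed

lemma strict_triangle_inequality:
  fixes A B C :: "'a::euclidean_space"
  assumes "\<not> collinear {A, B, C}"
  shows "dist B C < dist A B + dist C A"
proof -
  have "dist B C \<noteq> dist B A + dist A C"
    using assms between between_imp_collinear insert_commute by metis
  then show ?thesis
    using dist_triangle[of B C A] by (simp add: dist_commute)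
qed

section \<open>Lines tangent to a circle\<close>

lemma tangent_at_radius:
  assumes "tangent_at L Z \<rho> T"
  shows "T \<in> L" "dist T Z = \<rho>" "\<rho> > 0"
  using assms by (auto simp: tangent_at_def dist_commute)

text \<open>
  The reflection of the line in the foot of the perpendicular from \<open>Z\<close> preserves the distance to
  \<open>Z\<close>. Hence it maps \<open>T\<close> to a point of \<open>L\<close> on the circle, which can only be \<open>T\<close> itself, and so
  \<open>T\<close> is the foot.
\<close>

lemma tangent_at_orthogonal:
  assumes "tangent_at L Z \<rho> T" "X \<in> L"
  shows "(Z - T) \<bullet> (X - T) = 0"
proof (cases "X = T")
  case False
  define D where "D = X - T"
  \<comment> \<open>With this \<open>s\<close>, the point \<open>T + s D\<close> is the second intersection of the line \<open>TX\<close> with the circle.\<close>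
  define s where "s = 2 * ((Z - T) \<bullet> D) / (D \<bullet> D)"
  have DD: "D \<bullet> D \<noteq> 0" using False by (simp add: D_def)
  have T: "T \<in> L" "dist Z T = \<rho>"
    using tangent_at_radius[OF assms(1)] by (auto simp: dist_commute)
  have "T + s *\<^sub>R D \<in> L"
  proof -
    have "affine L" using assms(1) by (simp add: tangent_at_def is_line_def)
    then have "(1 - s) *\<^sub>R T + s *\<^sub>R X \<in> L"
      using T(1) assms(2) by (simp add: affine_alt)
    then show ?thesis by (simp add: D_def algebra_simps)
  qed
  moreover have "dist Z (T + s *\<^sub>R D) = dist Z T"
  proof -
    have "s * (D \<bullet> D) = 2 * ((Z - T) \<bullet> D)" using DD by (simp add: s_def)
    moreover have "(norm (Z - T - s *\<^sub>R D))\<^sup>2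
        = (norm (Z - T))\<^sup>2 + s * (s * (D \<bullet> D) - 2 * ((Z - T) \<bullet> D))"
      by (simp add: power2_norm_eq_inner inner_diff inner_commute algebra_simps)
    ultimately have "(norm (Z - T - s *\<^sub>R D))\<^sup>2 = (norm (Z - T))\<^sup>2" by simp
    then show ?thesis
      by (simp add: dist_norm diff_diff_eq)
  qed
  ultimately have "T + s *\<^sub>R D \<in> L \<inter> sphere Z \<rho>" using T(2) by simp
  then have "T + s *\<^sub>R D = T" using assms(1) unfolding tangent_at_def by blast
  then have "s = 0" using DD by auto
  then show ?thesis using DD by (simp add: s_def D_def)
qed simp

lemma tangent_length:
  assumes "tangent_at L Z \<rho> T" "X \<in> L"
  shows "(dist X Z)\<^sup>2 = \<rho>\<^sup>2 + (dist X T)\<^sup>2"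
proof -
  have "(norm (X - Z))\<^sup>2 = (norm (T - Z))\<^sup>2 + (norm (X - T))\<^sup>2 - 2 * ((Z - T) \<bullet> (X - T))"
    by (simp add: power2_norm_eq_inner inner_diff inner_commute algebra_simps)
  then show ?thesis
    using tangent_at_orthogonal[OF assms] tangent_at_radius(2)[OF assms(1)] by (simp add: dist_norm)
qed

lemma equal_tangent_lengths:
  assumes "tangent_at L Z \<rho> T" "tangent_at L' Z \<rho> T'" "X \<in> L" "X \<in> L'"
  shows "dist X T = dist X T'"
  using tangent_length[OF assms(1,3)] tangent_length[OF assms(2,4)]
  by (simp add: power2_eq_iff_nonneg)

lemma vertices_on_side_lines:
  shows "P \<in> affine hull {P, Q}" "Q \<in> affine hull {P, Q}"
  by (simp_all add: hull_inc)

lemma dist_in_segment: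
  fixes P Q T :: complex
  assumes "T \<in> closed_segment P Q"
  shows "dist P T + dist T Q = dist P Q"
  using assms by (simp add: between_mem_segment[symmetric] between)

section \<open>Circles inscribed in an angle of a triangle\<close>

text \<open>
  In terms of the angle \<open>\<alpha>\<close> at \<open>A\<close> this says \<open>\<rho>\<^sup>2 (1 + cos \<alpha>) = x\<^sup>2 (1 - cos \<alpha>)\<close> with \<open>x = AT\<close>, that is
  \<open>\<rho> = x tan (\<alpha> / 2)\<close>, where \<open>cos \<alpha>\<close> has been expressed by the sides. The squared form makes the
  ratio of \<open>\<rho>\<close> to \<open>x\<close> visibly the same for all circles inscribed in the angle. The centre is
  located through its inner products with the two sides, which are fixed by the tangency and
  force it onto the bisector.
\<close>

lemma radius_of_circle_in_angle:
  fixes A B C Z T T' :: complex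
  assumes noncoll: "\<not> collinear {A, B, C}"
    and T: "T \<in> closed_segment A B" "tangent_at (affine hull {A, B}) Z \<rho> T"
    and T': "T' \<in> closed_segment A C" "tangent_at (affine hull {A, C}) Z \<rho> T'"
  shows "\<rho>\<^sup>2 * ((dist C A + dist A B)\<^sup>2 - (dist B C)\<^sup>2)
       = (dist A T)\<^sup>2 * ((dist B C)\<^sup>2 - (dist C A - dist A B)\<^sup>2)"
proof -
  define U V W where "U = B - A" and "V = C - A" and "W = Z - A"
  define b c g x where "b = norm V" and "c = norm U" and "g = U \<bullet> V" and "x = dist A T"
  have ncoll: "\<not> collinear {0, U, V}"
  proof -
    have "collinear {B, A, C} \<longleftrightarrow> collinear {0, B - A, C - A}" by (rule collinear_3) simp
    then show ?thesis using noncoll by (metis U_def V_def insert_commute)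
  qed
  obtain k where k: "0 \<le> k" "T = A + k *\<^sub>R U"
    using T(1) by (auto simp: in_segment U_def algebra_simps)
  obtain l where l: "0 \<le> l" "T' = A + l *\<^sub>R V"
    using T'(1) by (auto simp: in_segment V_def algebra_simps)
  have xk: "x = k * c" using k by (simp add: x_def dist_norm c_def)
  have "dist A T = dist A T'"
    using equal_tangent_lengths[OF T(2) T'(2)] by (simp add: vertices_on_side_lines)
  then have xl: "x = l * b" using l by (simp add: x_def dist_norm b_def)
  have UU: "U \<bullet> U = c\<^sup>2" and VV: "V \<bullet> V = b\<^sup>2"
    by (simp_all add: b_def c_def power2_norm_eq_inner)
  have WU: "W \<bullet> U = x * c"
  proof -
    have "(Z - T) \<bullet> (B - T) - (Z - T) \<bullet> (A - T) = 0"
      using tangent_at_orthogonal[OF T(2)] by (simp add: vertices_on_side_lines)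
    then have "(W - k *\<^sub>R U) \<bullet> U = 0"
      unfolding inner_diff_right[symmetric] by (simp add: W_def U_def k(2) diff_diff_eq)
    then show ?thesis by (simp add: inner_diff_left UU xk power2_eq_square)
  qed
  have WV: "W \<bullet> V = x * b"
  proof -
    have "(Z - T') \<bullet> (C - T') - (Z - T') \<bullet> (A - T') = 0"
      using tangent_at_orthogonal[OF T'(2)] by (simp add: vertices_on_side_lines)
    then have "(W - l *\<^sub>R V) \<bullet> V = 0"
      unfolding inner_diff_right[symmetric] by (simp add: W_def V_def l(2) diff_diff_eq)
    then show ?thesis by (simp add: inner_diff_left VV xl power2_eq_square)
  qed
  \<comment> \<open>Both \<open>b U\<close> and \<open>c V\<close> have length \<open>b c\<close>, so that their sum spans the bisector.\<close>
  have bis: "(b * c + g) *\<^sub>R W = x *\<^sub>R (b *\<^sub>R U + c *\<^sub>R V)"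
  proof -
    have "(b * c + g) *\<^sub>R W - x *\<^sub>R (b *\<^sub>R U + c *\<^sub>R V) = 0"
    proof (rule orthogonal_both_imp_zero[OF ncoll])
      have VU: "V \<bullet> U = g" by (simp add: g_def inner_commute)
      show "((b * c + g) *\<^sub>R W - x *\<^sub>R (b *\<^sub>R U + c *\<^sub>R V)) \<bullet> U = 0"
        by (simp add: inner_diff_left inner_add_left UU VU WU power2_eq_square algebra_simps)
      show "((b * c + g) *\<^sub>R W - x *\<^sub>R (b *\<^sub>R U + c *\<^sub>R V)) \<bullet> V = 0"
        by (simp add: inner_diff_left inner_add_left VV WV power2_eq_square algebra_simps flip: g_def)
    qed
    then show ?thesis by simp
  qed
  have "(b * c + g) * (b * c + g) * (W \<bullet> W)
      = ((b * c + g) *\<^sub>R W) \<bullet> ((b * c + g) *\<^sub>R W)" by simp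
  also have "\<dots> = x\<^sup>2 * (2 * (b * c) * (b * c + g))"
    unfolding bis
    by (simp add: inner_add_left inner_add_right inner_commute[of V U] UU VV power2_eq_square
      algebra_simps flip: g_def)
  finally have sq: "(b * c + g) * (b * c + g) * (W \<bullet> W) = x\<^sup>2 * (2 * (b * c) * (b * c + g))" .
  have "\<bar>g\<bar> \<noteq> c * b"
    using ncoll norm_cauchy_schwarz_equal unfolding g_def b_def c_def by blast
  moreover have "c * b \<ge> 0" by (simp add: b_def c_def)
  ultimately have nz: "b * c + g \<noteq> 0" by (auto simp: mult.commute add_eq_0_iff)
  have WW: "W \<bullet> W = \<rho>\<^sup>2 + x\<^sup>2"
    using tangent_length[OF T(2), of A]
    by (simp add: vertices_on_side_lines W_def x_def dist_norm norm_minus_commute[of A] flip: power2_norm_eq_inner)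
  have "(b * c + g) * (\<rho>\<^sup>2 + x\<^sup>2) = 2 * x\<^sup>2 * (b * c)"
  proof -
    have "(b * c + g) * ((b * c + g) * (\<rho>\<^sup>2 + x\<^sup>2)) = (b * c + g) * (2 * x\<^sup>2 * (b * c))"
      using sq unfolding WW by (simp only: ac_simps)
    then show ?thesis using nz by simp
  qed
  then have main: "\<rho>\<^sup>2 * (b * c + g) = x\<^sup>2 * (b * c - g)" by (simp add: algebra_simps)
  have "(dist B C)\<^sup>2 = b\<^sup>2 + c\<^sup>2 - 2 * g"
  proof -
    have "B - C = U - V" by (simp add: U_def V_def)
    then show ?thesis
      by (simp add: dist_norm power2_norm_eq_inner inner_diff_left inner_diff_right UU VV g_def
        inner_commute[of V U])
  qed
  moreover have "dist C A = b" "dist A B = c"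
    by (simp_all add: b_def c_def U_def V_def dist_norm norm_minus_commute)
  ultimately have "(dist C A + dist A B)\<^sup>2 - (dist B C)\<^sup>2 = 2 * (b * c + g)"
    "(dist B C)\<^sup>2 - (dist C A - dist A B)\<^sup>2 = 2 * (b * c - g)"
    by (simp_all add: power2_eq_square algebra_simps)
  with main show ?thesis unfolding x_def[symmetric] by algebra
qed

lemma incircle_rotate: "incircle A B C I r \<Longrightarrow> incircle B C A I r"
  by (auto simp: incircle_def insert_commute)

text \<open>
  The tangents from \<open>A\<close>, \<open>B\<close>, \<open>C\<close> to the incircle have lengths \<open>p\<close>, \<open>q\<close>, \<open>w\<close>; the last conclusion
  is Heron's formula \<open>s r\<^sup>2 = (s - a) (s - b) (s - c)\<close>. It is the relation of
  \<open>radius_of_circle_in_angle\<close> for \<open>x = p\<close>, whose two factors split by the difference of squares.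
\<close>

lemma incircle_inradius:
  fixes A B C I :: complex
  assumes noncoll: "\<not> collinear {A, B, C}" and inc: "incircle A B C I r"
  defines "p \<equiv> (dist C A + dist A B - dist B C) / 2"
    and "q \<equiv> (dist A B + dist B C - dist C A) / 2"
    and "w \<equiv> (dist B C + dist C A - dist A B) / 2"
  shows "r > 0" "p > 0" "r\<^sup>2 * (p + q + w) = p * q * w"
proof -
  obtain F D E where F: "F \<in> closed_segment A B" "tangent_at (affine hull {A, B}) I r F"
    and D: "D \<in> closed_segment B C" "tangent_at (affine hull {B, C}) I r D"
    and E: "E \<in> closed_segment C A" "tangent_at (affine hull {C, A}) I r E"
    using inc by (auto simp: incircle_def tangent_to_side_def)
  show "r > 0" using tangent_at_radius(3)[OF F(2)] .
  show p0: "p > 0"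
    using strict_triangle_inequality[OF noncoll] by (simp add: p_def)
  have "dist A F = dist A E" "dist B F = dist B D" "dist C D = dist C E"
    using equal_tangent_lengths[OF F(2) E(2)] equal_tangent_lengths[OF F(2) D(2)]
      equal_tangent_lengths[OF D(2) E(2)] by (simp_all add: vertices_on_side_lines)
  with dist_in_segment[OF F(1)] dist_in_segment[OF D(1)] dist_in_segment[OF E(1)]
  have AF: "dist A F = p" unfolding p_def by (simp add: dist_commute)
  have "r\<^sup>2 * ((dist C A + dist A B)\<^sup>2 - (dist B C)\<^sup>2)
       = p\<^sup>2 * ((dist B C)\<^sup>2 - (dist C A - dist A B)\<^sup>2)"
    using radius_of_circle_in_angle[OF noncoll F] E AF
    by (simp add: insert_commute closed_segment_commute)
  moreover have "(dist C A + dist A B)\<^sup>2 - (dist B C)\<^sup>2 = 4 * p * (p + q + w)"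
    "(dist B C)\<^sup>2 - (dist C A - dist A B)\<^sup>2 = 4 * q * w"
    unfolding p_def q_def w_def by (simp_all add: power2_eq_square field_simps)
  ultimately have "r\<^sup>2 * (4 * p * (p + q + w)) = p\<^sup>2 * (4 * q * w)" by simp
  then have "p * (r\<^sup>2 * (p + q + w)) = p * (p * q * w)" by algebra
  then show "r\<^sup>2 * (p + q + w) = p * q * w" using p0 by simp
qed

section \<open>Externally tangent circles\<close>

text \<open>
  Disjoint open discs have their centres at distance at least \<open>\<rho> + R\<close>, so that the path from \<open>Z\<close>
  to \<open>K\<close> through \<open>T\<close> attains equality in the triangle inequality and is straight.
\<close>

lemma externally_tangent_contact:
  assumes "externally_tangent_at Z \<rho> K R T"
  shows "R *\<^sub>R (Z - T) = \<rho> *\<^sub>R (T - K)"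
proof -
  have pos: "\<rho> > 0" "R > 0" and T: "norm (Z - T) = \<rho>" "norm (T - K) = R"
    and disj: "ball Z \<rho> \<inter> ball K R = {}"
    using assms by (auto simp: externally_tangent_at_def dist_norm norm_minus_commute)
  have "dist Z K \<ge> \<rho> + R"
  proof (rule ccontr)
    assume "\<not> ?thesis"
    then have d: "dist Z K < \<rho> + R" by simp
    \<comment> \<open>The point dividing \<open>ZK\<close> in the ratio \<open>\<rho> : R\<close> would lie in both discs.\<close>
    define s where "s = \<rho> / (\<rho> + R)"
    define X where "X = Z + s *\<^sub>R (K - Z)"
    have s: "0 < s" "0 < 1 - s" "s * (\<rho> + R) = \<rho>" "(1 - s) * (\<rho> + R) = R"
      using pos by (simp_all add: s_def field_simps)
    have "dist Z X = s * dist Z K"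
      using s by (simp add: X_def dist_norm norm_minus_commute)
    also have "\<dots> < \<rho>" using mult_strict_left_mono[OF d s(1)] s(3) by simp
    finally have 1: "X \<in> ball Z \<rho>" by simp
    have "K - X = (1 - s) *\<^sub>R (K - Z)" by (simp add: X_def algebra_simps)
    then have "dist K X = (1 - s) * dist Z K"
      using s by (simp add: dist_norm norm_minus_commute)
    also have "\<dots> < R" using mult_strict_left_mono[OF d s(2)] s(4) by simp
    finally have "X \<in> ball K R" by simp
    with 1 disj show False by blast
  qed
  moreover have "norm ((Z - T) + (T - K)) \<le> \<rho> + R"
    using norm_triangle_ineq[of "Z - T" "T - K"] T by simp
  ultimately have "norm ((Z - T) + (T - K)) = norm (Z - T) + norm (T - K)"
    using T by (simp add: dist_norm)
  then show ?thesis using T unfolding norm_triangle_eq by simp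
qed

text \<open>
  The special case of Casey's theorem for a point circle: by \<open>tangent_length\<close>, the difference
  \<open>XZ\<^sup>2 - \<rho>\<^sup>2\<close> is the square of the tangent from \<open>X\<close> to the circle about \<open>Z\<close>, so this tangent is
  a fixed multiple of the chord \<open>XT\<close>.
\<close>

lemma externally_tangent_power:
  assumes ext: "externally_tangent_at Z \<rho> K R T" and X: "dist K X = R"
  shows "R * ((dist X Z)\<^sup>2 - \<rho>\<^sup>2) = (R + \<rho>) * (dist X T)\<^sup>2"
proof -
  define u y where "u = T - K" and "y = X - K"
  have R: "R > 0" and "norm u = R"
    using ext by (auto simp: externally_tangent_at_def u_def dist_norm norm_minus_commute)
  then have u: "u \<bullet> u = R\<^sup>2" by (simp flip: power2_norm_eq_inner)
  have y: "y \<bullet> y = R\<^sup>2"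
    using X by (simp add: y_def dist_norm norm_minus_commute flip: power2_norm_eq_inner)
  have XT: "(dist X T)\<^sup>2 = 2 * R\<^sup>2 - 2 * (y \<bullet> u)"
  proof -
    have "X - T = y - u" by (simp add: y_def u_def)
    then show ?thesis
      by (simp add: dist_norm power2_norm_eq_inner inner_diff inner_commute u y)
  qed
  have "R *\<^sub>R (X - Z) = R *\<^sub>R y - (R + \<rho>) *\<^sub>R u"
    using externally_tangent_contact[OF ext] by (simp add: y_def u_def algebra_simps)
  then have "(R *\<^sub>R (X - Z)) \<bullet> (R *\<^sub>R (X - Z))
      = R\<^sup>2 * R\<^sup>2 + (R + \<rho>)\<^sup>2 * R\<^sup>2 - 2 * R * (R + \<rho>) * (y \<bullet> u)"
    by (simp only: inner_diff_left inner_diff_right inner_scaleR_left inner_scaleR_right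
      inner_commute[of u y] u y) (simp add: power2_eq_square algebra_simps)
  then have "R * (R * (dist X Z)\<^sup>2) = R * (R * R\<^sup>2 + (R + \<rho>)\<^sup>2 * R - 2 * (R + \<rho>) * (y \<bullet> u))"
    unfolding inner_scaleR_left inner_scaleR_right dist_norm power2_norm_eq_inner
    by (simp only: power2_eq_square ring_distribs ac_simps)
  then have "R * (dist X Z)\<^sup>2 = R * R\<^sup>2 + (R + \<rho>)\<^sup>2 * R - 2 * (R + \<rho>) * (y \<bullet> u)"
    using R by simp
  then show ?thesis unfolding XT by (simp add: power2_eq_square algebra_simps)
qed

section \<open>Arcs and inscribed angles\<close>

lemma dist_on_circle:
  fixes K :: complex
  assumes "R \<ge> 0"
  shows "dist (K + of_real R * cis \<alpha>) (K + of_real R * cis \<beta>) = 2 * R * \<bar>sin ((\<alpha> - \<beta>) / 2)\<bar>"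
proof -
  have "(norm (cis \<alpha> - cis \<beta>))\<^sup>2 = (2 * \<bar>sin ((\<alpha> - \<beta>) / 2)\<bar>)\<^sup>2"
  proof -
    have "(norm (cis \<alpha> - cis \<beta>))\<^sup>2 = (cos \<alpha> - cos \<beta>)\<^sup>2 + (sin \<alpha> - sin \<beta>)\<^sup>2"
      by (simp add: cmod_power2)
    also have "\<dots> = 2 - 2 * cos (\<alpha> - \<beta>)"
      using sin_cos_squared_add[of \<alpha>] sin_cos_squared_add[of \<beta>]
      by (simp add: cos_diff power2_eq_square algebra_simps)
    also have "\<dots> = (2 * \<bar>sin ((\<alpha> - \<beta>) / 2)\<bar>)\<^sup>2"
      using cos_double_sin[of "(\<alpha> - \<beta>) / 2"]
      unfolding field_sum_of_halves mult_2 by (simp add: power_mult_distrib)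
    finally show ?thesis .
  qed
  then have "norm (cis \<alpha> - cis \<beta>) = 2 * \<bar>sin ((\<alpha> - \<beta>) / 2)\<bar>"
    by (rule power2_eq_imp_eq) simp_all
  moreover have "dist (K + of_real R * cis \<alpha>) (K + of_real R * cis \<beta>) = R * norm (cis \<alpha> - cis \<beta>)"
    using assms by (simp add: dist_norm norm_mult flip: right_diff_distrib)
  ultimately show ?thesis by simp
qed

text \<open>
  The last conclusion is the law of cosines in the triangle \<open>BTC\<close>, whose angle at \<open>T\<close> is
  \<open>pi - \<theta> / 2\<close>. Phrased with distances only, it also covers the endpoints of the arc, where
  that angle does not exist. It reduces to an addition theorem: the chords \<open>BT\<close>, \<open>CT\<close>, \<open>BC\<close> are
  \<open>2 R sin u\<close>, \<open>2 R sin v\<close>, \<open>2 R sin (u + v)\<close>, where \<open>u\<close> and \<open>v\<close> are half the measures of the two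
  parts into which \<open>T\<close> divides the arc.
\<close>

lemma arc_inscribed_angle:
  assumes arc: "erected_arc A B C \<theta> K R \<phi>" and \<theta>: "0 < \<theta>" "\<theta> < 2 * pi"
    and T: "T \<in> path_image (part_circlepath K R \<phi> (\<phi> + \<theta>))"
  shows "dist K B = R" "dist K C = R" "dist B C = 2 * R * sin (\<theta> / 2)"
    "(dist B C)\<^sup>2 = (dist B T)\<^sup>2 + (dist C T)\<^sup>2 + 2 * dist B T * dist C T * cos (\<theta> / 2)"
proof -
  define P Q where "P = K + of_real R * cis \<phi>" and "Q = K + of_real R * cis (\<phi> + \<theta>)"
  have R: "R > 0" and ends: "{P, Q} = {B, C}"
    using arc by (simp_all add: erected_arc_def P_def Q_def cis_conv_exp)
  obtain \<psi> where \<psi>: "\<phi> \<le> \<psi>" "\<psi> \<le> \<phi> + \<theta>" "T = K + of_real R * cis \<psi>"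
    using T \<theta> by (auto simp: path_image_part_circlepath cis_conv_exp)
  define u v where "u = (\<psi> - \<phi>) / 2" and "v = (\<phi> + \<theta> - \<psi>) / 2"
  have uv: "u + v = \<theta> / 2" "0 \<le> u" "0 \<le> v" "u \<le> pi" "v \<le> pi"
    using \<psi> \<theta> by (auto simp: u_def v_def field_simps)
  have PT: "dist P T = 2 * R * sin u"
    using dist_on_circle[of R K \<psi> \<phi>] R sin_ge_zero[of u] uv
    unfolding P_def \<psi>(3) by (simp add: u_def dist_commute)
  have QT: "dist Q T = 2 * R * sin v"
    using dist_on_circle[of R K "\<phi> + \<theta>" \<psi>] R sin_ge_zero[of v] uv
    unfolding Q_def \<psi>(3) by (simp add: v_def)
  have PQ: "dist P Q = 2 * R * sin (\<theta> / 2)"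
    using dist_on_circle[of R K "\<phi> + \<theta>" \<phi>] R sin_ge_zero[of "\<theta> / 2"] \<theta>
    unfolding P_def Q_def by (simp add: dist_commute)
  have "(sin (u + v))\<^sup>2 = (sin u)\<^sup>2 + (sin v)\<^sup>2 + 2 * sin u * sin v * cos (u + v)"
    using sin_cos_squared_add[of u] sin_cos_squared_add[of v] unfolding sin_add cos_add by algebra
  then have law: "(dist P Q)\<^sup>2 = (dist P T)\<^sup>2 + (dist Q T)\<^sup>2 + 2 * dist P T * dist Q T * cos (\<theta> / 2)"
    unfolding PT QT PQ uv(1) by (simp add: power_mult_distrib power2_eq_square algebra_simps)
  have KPQ: "dist K P = R" "dist K Q = R"
    using R by (simp_all add: P_def Q_def dist_norm norm_mult)
  have "P = B \<and> Q = C \<or> P = C \<and> Q = B" using ends by (auto simp: doubleton_eq_iff)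
  then show "dist K B = R" "dist K C = R" "dist B C = 2 * R * sin (\<theta> / 2)"
    "(dist B C)\<^sup>2 = (dist B T)\<^sup>2 + (dist C T)\<^sup>2 + 2 * dist B T * dist C T * cos (\<theta> / 2)"
    using KPQ PQ law by (auto simp: dist_commute)
qed

section \<open>The circles of the general triad\<close>

text \<open>
  In the unknown \<open>\<delta> = p - x\<close> the equation factors as
  \<open>(r t - \<delta>) (p (\<delta> + q + w) + (p + q + w) r t) = 0\<close>. The hypotheses \<open>x \<le> p + q\<close> and \<open>x \<le> p + w\<close>
  express that the contact points do not lie beyond \<open>B\<close> and \<open>C\<close>; they make the second factor
  positive and so select the right circle among the solutions.
\<close>

lemma contact_distance_equation:
  fixes p q w r x \<rho> t :: real
  assumes p: "p > 0" and q: "q \<ge> 0" and w: "w \<ge> 0" and r: "r > 0" and t: "t > 0"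
    and inr: "r\<^sup>2 * (p + q + w) = p * q * w"
    and hom: "\<rho> * p = r * x"
    and sides: "x \<le> p + q" "x \<le> p + w"
    and eq: "(q + w)\<^sup>2 * (1 + t\<^sup>2) + 4 * (q + w) * t * \<rho> = (2 * p + q + w - 2 * x)\<^sup>2 + (w - q)\<^sup>2 * t\<^sup>2"
  shows "x = p - r * t"
proof -
  define \<delta> where "\<delta> = p - x"
  have x: "x = p - \<delta>" by (simp add: \<delta>_def)
  have "(q + w) * t * \<rho> + q * w * t\<^sup>2 = (q + w) * \<delta> + \<delta>\<^sup>2"
    using eq unfolding x by (simp add: power2_eq_square algebra_simps)
  then have "(q + w) * t * (\<rho> * p) + p * q * w * t\<^sup>2 = p * ((q + w) * \<delta> + \<delta>\<^sup>2)" by algebra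
  then have "(q + w) * t * (r * (p - \<delta>)) + r\<^sup>2 * (p + q + w) * t\<^sup>2 = p * ((q + w) * \<delta> + \<delta>\<^sup>2)"
    unfolding hom inr x .
  then have "(r * t - \<delta>) * (p * (\<delta> + q + w) + (p + q + w) * r * t) = 0" by algebra
  moreover have "p * (\<delta> + q + w) + (p + q + w) * r * t > 0"
  proof -
    have "\<delta> + q + w \<ge> 0" using sides q w by (simp add: \<delta>_def)
    then have "p * (\<delta> + q + w) \<ge> 0" using p by simp
    moreover have "(p + q + w) * r * t > 0" using p q w r t by simp
    ultimately show ?thesis by simp
  qed
  ultimately show ?thesis by (simp add: \<delta>_def)
qed

text \<open>
  All lengths are expressed by the tangent lengths \<open>p\<close>, \<open>q\<close>, \<open>w\<close> of the incircle and by \<open>x = AT\<close>;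
  combining Casey's relation at \<open>B\<close> and \<open>C\<close> with the law of cosines for the arc then produces
  the hypothesis of \<open>contact_distance_equation\<close>.
\<close>

lemma triad_circle_contact:
  fixes A B C I Z :: complex
  assumes noncoll: "\<not> collinear {A, B, C}" and inc: "incircle A B C I r"
    and \<theta>: "0 < \<theta>" "\<theta> < 2 * pi" and triad: "triad_circle A B C \<theta> Z \<rho>"
  obtains T T' where "T \<in> closed_segment A B" "tangent_at (affine hull {A, B}) Z \<rho> T"
    "T' \<in> closed_segment A C" "tangent_at (affine hull {A, C}) Z \<rho> T'"
    "dist A T = (dist C A + dist A B - dist B C) / 2 - r * tan (\<theta> / 4)"
    "dist A T' = (dist C A + dist A B - dist B C) / 2 - r * tan (\<theta> / 4)"
proof -
  define a b c where "a = dist B C" and "b = dist C A" and "c = dist A B"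
  define p q w where "p = (b + c - a) / 2" and "q = (c + a - b) / 2" and "w = (a + b - c) / 2"
  define S Co t where "S = sin (\<theta> / 4)" and "Co = cos (\<theta> / 4)" and "t = tan (\<theta> / 4)"
  obtain T T' where T: "T \<in> closed_segment A B" "tangent_at (affine hull {A, B}) Z \<rho> T"
    and T': "T' \<in> closed_segment A C" "tangent_at (affine hull {A, C}) Z \<rho> T'"
    using triad by (auto simp: triad_circle_def tangent_to_side_def)
  obtain K R \<phi> X where arc: "erected_arc A B C \<theta> K R \<phi>"
    and X: "X \<in> path_image (part_circlepath K R \<phi> (\<phi> + \<theta>))"
    and ext: "externally_tangent_at Z \<rho> K R X"
    using triad by (auto simp: triad_circle_def)
  define x where "x = dist A T"
  have xT': "dist A T' = x"
    using equal_tangent_lengths[OF T(2) T'(2)] by (simp add: vertices_on_side_lines x_def)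
  have BT: "dist B T = c - x"
    using dist_in_segment[OF T(1)] by (simp add: x_def c_def dist_commute)
  have CT': "dist C T' = b - x"
    using dist_in_segment[OF T'(1)] xT' by (simp add: b_def dist_commute)
  have sides: "x \<le> c" "x \<le> b" using BT CT' zero_le_dist[of B T] zero_le_dist[of C T'] by linarith+
  have R: "R > 0" and \<rho>: "\<rho> > 0" using ext by (simp_all add: externally_tangent_at_def)
  have r: "r > 0" and p: "p > 0" and inr: "r\<^sup>2 * (p + q + w) = p * q * w"
    using incircle_inradius[OF noncoll inc] by (simp_all add: p_def q_def w_def a_def b_def c_def)
  have qw: "q \<ge> 0" "w \<ge> 0"
    using dist_triangle[of C A B] dist_triangle[of A B C]
    by (simp_all add: q_def w_def a_def b_def c_def dist_commute)
  have abc: "a = q + w" "b = p + w" "c = p + q" by (simp_all add: p_def q_def w_def field_simps)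
  \<comment> \<open>The homothety from \<open>A\<close> that takes the incircle to the triad circle.\<close>
  have hom: "\<rho> * p = r * x"
  proof -
    have "\<rho>\<^sup>2 * ((b + c)\<^sup>2 - a\<^sup>2) = x\<^sup>2 * (a\<^sup>2 - (b - c)\<^sup>2)"
      using radius_of_circle_in_angle[OF noncoll T T'] by (simp add: a_def b_def c_def x_def)
    then have "\<rho>\<^sup>2 * (p * (p + q + w)) = x\<^sup>2 * (q * w)"
      unfolding abc by algebra
    then have "p * (\<rho>\<^sup>2 * (p * (p + q + w))) = x\<^sup>2 * (r\<^sup>2 * (p + q + w))"
      unfolding inr by algebra
    then have "(p + q + w) * (\<rho> * p)\<^sup>2 = (p + q + w) * (r * x)\<^sup>2" by algebra
    then have "(\<rho> * p)\<^sup>2 = (r * x)\<^sup>2" using p qw by simp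
    moreover have "x \<ge> 0" by (simp add: x_def)
    ultimately show ?thesis using p \<rho> r by (simp add: power2_eq_iff_nonneg)
  qed
  note insc = arc_inscribed_angle[OF arc \<theta> X]
  have powB: "R * (c - x)\<^sup>2 = (R + \<rho>) * (dist B X)\<^sup>2"
    using externally_tangent_power[OF ext insc(1)] tangent_length[OF T(2), of B]
    by (simp add: vertices_on_side_lines BT)
  have powC: "R * (b - x)\<^sup>2 = (R + \<rho>) * (dist C X)\<^sup>2"
    using externally_tangent_power[OF ext insc(2)] tangent_length[OF T'(2), of C]
    by (simp add: vertices_on_side_lines CT')
  \<comment> \<open>The root has this sign because \<open>x \<le> b\<close> and \<open>x \<le> c\<close>.\<close>
  have powBC: "R * ((c - x) * (b - x)) = (R + \<rho>) * (dist B X * dist C X)"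
  proof -
    have "(R * (c - x)\<^sup>2) * (R * (b - x)\<^sup>2) = ((R + \<rho>) * (dist B X)\<^sup>2) * ((R + \<rho>) * (dist C X)\<^sup>2)"
      unfolding powB powC ..
    then have "(R * ((c - x) * (b - x)))\<^sup>2 = ((R + \<rho>) * (dist B X * dist C X))\<^sup>2" by algebra
    then show ?thesis using R \<rho> sides by (simp add: power2_eq_iff_nonneg)
  qed
  have "(R + \<rho>) * a\<^sup>2 = R * ((c - x)\<^sup>2 + (b - x)\<^sup>2 + 2 * ((c - x) * (b - x)) * cos (\<theta> / 2))"
    using insc(4) powB powC powBC unfolding a_def by algebra
  moreover have "a = 2 * R * sin (\<theta> / 2)" using insc(3) by (simp add: a_def)
  ultimately have "R * (a\<^sup>2 + 2 * a * \<rho> * sin (\<theta> / 2))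
      = R * ((c - x)\<^sup>2 + (b - x)\<^sup>2 + 2 * ((c - x) * (b - x)) * cos (\<theta> / 2))" by algebra
  then have casey: "a\<^sup>2 + 2 * a * \<rho> * sin (\<theta> / 2)
      = (c - x)\<^sup>2 + (b - x)\<^sup>2 + 2 * ((c - x) * (b - x)) * cos (\<theta> / 2)" using R by simp
  have Co: "Co > 0" unfolding Co_def using \<theta> by (intro cos_gt_zero) auto
  have t: "t > 0" unfolding t_def using \<theta> by (intro tan_gt_zero) auto
  have S: "S = t * Co" using Co by (simp add: S_def t_def tan_def flip: Co_def)
  have unit: "Co\<^sup>2 * (1 + t\<^sup>2) = 1"
    using sin_cos_squared_add[of "\<theta> / 4"] S by (simp add: power_mult_distrib algebra_simps flip: S_def Co_def)
  \<comment> \<open>Half-angle substitution; multiplying out with \<open>unit\<close> leaves a polynomial equation in \<open>t\<close>.\<close>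
  have half: "sin (\<theta> / 2) = 2 * t * Co\<^sup>2" "cos (\<theta> / 2) = Co\<^sup>2 * (1 - t\<^sup>2)"
    using sin_double[of "\<theta> / 4"] cos_double[of "\<theta> / 4"] S
    by (simp_all add: power_mult_distrib algebra_simps power2_eq_square flip: S_def Co_def)
  have "Co\<^sup>2 * (a\<^sup>2 * (1 + t\<^sup>2) + 4 * a * t * \<rho>)
      = Co\<^sup>2 * (((c - x)\<^sup>2 + (b - x)\<^sup>2) * (1 + t\<^sup>2) + 2 * ((c - x) * (b - x)) * (1 - t\<^sup>2))"
    using casey unit unfolding half by algebra
  then have "a\<^sup>2 * (1 + t\<^sup>2) + 4 * a * t * \<rho>
      = ((c - x)\<^sup>2 + (b - x)\<^sup>2) * (1 + t\<^sup>2) + 2 * ((c - x) * (b - x)) * (1 - t\<^sup>2)"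
    using Co by simp
  also have "\<dots> = (b + c - 2 * x)\<^sup>2 + (b - c)\<^sup>2 * t\<^sup>2" by algebra
  finally have "(q + w)\<^sup>2 * (1 + t\<^sup>2) + 4 * (q + w) * t * \<rho> = (2 * p + q + w - 2 * x)\<^sup>2 + (w - q)\<^sup>2 * t\<^sup>2"
    unfolding abc by (simp add: algebra_simps)
  then have "x = p - r * t"
    using contact_distance_equation[OF p qw r t inr hom] sides unfolding abc by blast
  then show ?thesis
    using that[OF T T'] xT' by (simp add: x_def p_def t_def a_def b_def c_def)
qed

section \<open>Common external tangents\<close>

text \<open>
  In coordinates with \<open>L\<close> as the axis, the centres have heights \<open>\<plusminus>\<rho>\<^sub>1\<close> and \<open>\<plusminus>\<rho>\<^sub>2\<close> above their contact
  points, with equal signs because they lie on the same side. Hence the heights differ by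
  \<open>\<bar>\<rho>\<^sub>1 - \<rho>\<^sub>2\<bar>\<close>, and Pythagoras applies.
\<close>

lemma external_tangent_length:
  assumes "common_external_tangent L Z\<^sub>1 \<rho>\<^sub>1 P Z\<^sub>2 \<rho>\<^sub>2 Q"
  shows "(dist P Q)\<^sup>2 = (dist Z\<^sub>1 Z\<^sub>2)\<^sup>2 - (\<rho>\<^sub>1 - \<rho>\<^sub>2)\<^sup>2"
proof -
  have t1: "tangent_at L Z\<^sub>1 \<rho>\<^sub>1 P" and t2: "tangent_at L Z\<^sub>2 \<rho>\<^sub>2 Q"
    and side: "closed_segment Z\<^sub>1 Z\<^sub>2 \<inter> L = {}" and L: "affine L" "aff_dim L = 1"
    using assms by (auto simp: common_external_tangent_def same_side_def tangent_at_def is_line_def)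
  obtain G where G: "\<not> affine_dependent G" "G \<subseteq> L" "affine hull L = affine hull G"
    using affine_basis_exists by blast
  have "int (card G) = 2" using aff_dim_unique[of G L] G L(2) by simp
  then have "card G = 2" by simp
  then obtain U V where UV: "G = {U, V}" "U \<noteq> V" by (meson card_2_iff)
  define D where "D = V - U"
  have D: "D \<noteq> 0" using UV by (simp add: D_def)
  have LUV: "L = range (\<lambda>s. U + s *\<^sub>R D)"
    using G(3) L(1) UV affine_hull_2_alt[of U V] by (simp add: D_def affine_hull_eq[THEN iffD2])
  obtain k l where kl: "P = U + k *\<^sub>R D" "Q = U + l *\<^sub>R D"
    using tangent_at_radius(1)[OF t1] tangent_at_radius(1)[OF t2] unfolding LUV by blast
  have perp: "(Z - N) \<bullet> D = 0" if "tangent_at L Z \<rho> N" for Z N \<rho>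
  proof -
    have "V \<in> L" "U \<in> L" using G(2) UV by auto
    then have "(Z - N) \<bullet> (V - N) - (Z - N) \<bullet> (U - N) = 0"
      using tangent_at_orthogonal[OF that] by simp
    then show ?thesis unfolding inner_diff_right[symmetric] by (simp add: D_def)
  qed
  obtain s1 where s1: "Z\<^sub>1 - P = s1 *\<^sub>R (\<i> * D)"
    using orthogonal_imp_multiple_of_normal[OF D perp[OF t1]] .
  obtain s2 where s2: "Z\<^sub>2 - Q = s2 *\<^sub>R (\<i> * D)"
    using orthogonal_imp_multiple_of_normal[OF D perp[OF t2]] .
  have \<rho>: "\<rho>\<^sub>1 = \<bar>s1\<bar> * norm D" "\<rho>\<^sub>2 = \<bar>s2\<bar> * norm D"
    using tangent_at_radius(2)[OF t1] tangent_at_radius(2)[OF t2]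
    by (simp_all add: dist_norm norm_minus_commute[of P] norm_minus_commute[of Q] s1 s2 norm_mult)
  have pos: "s1 * s2 > 0"
  proof (rule ccontr)
    assume neg: "\<not> s1 * s2 > 0"
    have nz: "s1 \<noteq> 0" "s2 \<noteq> 0"
      using \<rho> tangent_at_radius(3)[OF t1] tangent_at_radius(3)[OF t2] by auto
    \<comment> \<open>If the signs differ, the segment between the centres crosses \<open>L\<close> at this parameter.\<close>
    define m where "m = s1 / (s1 - s2)"
    have m: "0 \<le> m" "m \<le> 1" "(1 - m) * s1 + m * s2 = 0"
      using neg nz unfolding m_def by (auto simp: zero_less_mult_iff field_simps not_less)
    have "(1 - m) *\<^sub>R Z\<^sub>1 + m *\<^sub>R Z\<^sub>2
        = (1 - m) *\<^sub>R P + m *\<^sub>R Q + ((1 - m) * s1 + m * s2) *\<^sub>R (\<i> * D)"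
    proof -
      have "Z\<^sub>1 = P + s1 *\<^sub>R (\<i> * D)" "Z\<^sub>2 = Q + s2 *\<^sub>R (\<i> * D)"
        using s1 s2 by (simp_all add: algebra_simps)
      then show ?thesis by (simp add: scaleR_conv_of_real algebra_simps)
    qed
    also have "\<dots> \<in> L"
      using m(3) L(1) tangent_at_radius(1)[OF t1] tangent_at_radius(1)[OF t2] by (simp add: affine_alt)
    finally have "(1 - m) *\<^sub>R Z\<^sub>1 + m *\<^sub>R Z\<^sub>2 \<in> L" .
    moreover have "(1 - m) *\<^sub>R Z\<^sub>1 + m *\<^sub>R Z\<^sub>2 \<in> closed_segment Z\<^sub>1 Z\<^sub>2"
      using m by (auto simp: in_segment)
    ultimately show False using side by blast
  qed
  have "(\<rho>\<^sub>1 - \<rho>\<^sub>2)\<^sup>2 = (s1 - s2)\<^sup>2 * (norm D)\<^sup>2"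
  proof -
    have "(\<bar>s1\<bar> - \<bar>s2\<bar>)\<^sup>2 = (s1 - s2)\<^sup>2"
      using pos by (simp add: power2_diff flip: abs_mult)
    then show ?thesis unfolding \<rho> left_diff_distrib[symmetric] by (simp only: power_mult_distrib)
  qed
  moreover have "dist P Q = \<bar>k - l\<bar> * norm D"
    by (simp add: kl dist_norm flip: scaleR_left_diff_distrib)
  moreover have "(dist Z\<^sub>1 Z\<^sub>2)\<^sup>2 = ((k - l)\<^sup>2 + (s1 - s2)\<^sup>2) * (norm D)\<^sup>2"
  proof -
    have "Z\<^sub>1 - Z\<^sub>2 = Complex (k - l) (s1 - s2) * D"
      using s1 s2 kl by (simp add: complex_eq_iff algebra_simps)
    then show ?thesis by (simp add: dist_norm norm_mult power_mult_distrib cmod_power2)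
  qed
  ultimately show ?thesis by (simp add: power_mult_distrib algebra_simps)
qed

text \<open>
  The signed height above \<open>AB\<close> has the sign of that of \<open>C\<close> on the whole triangle except the side
  \<open>AB\<close>, and the centre of a circle tangent to \<open>AB\<close> is not on \<open>AB\<close>.
\<close>

lemma tangent_circles_in_triangle_same_side:
  fixes A B C :: complex
  assumes "\<not> collinear {A, B, C}"
    and "Z\<^sub>1 \<in> convex hull {A, B, C}" "Z\<^sub>2 \<in> convex hull {A, B, C}"
    and "tangent_at (affine hull {A, B}) Z\<^sub>1 \<rho>\<^sub>1 T\<^sub>1" "tangent_at (affine hull {A, B}) Z\<^sub>2 \<rho>\<^sub>2 T\<^sub>2"
  shows "same_side (affine hull {A, B}) Z\<^sub>1 Z\<^sub>2"
proof -
  define N h where "N = \<i> * (B - A)" and "h X = N \<bullet> (X - A)" for X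
  have h_affine: "h (u *\<^sub>R X + v *\<^sub>R Y) = u * h X + v * h Y" if "u + v = 1" for u v X Y
  proof -
    have v: "v = 1 - u" using that by simp
    show ?thesis unfolding h_def v by (simp add: inner_diff_right inner_add_right algebra_simps)
  qed
  have hA: "h A = 0" by (simp add: h_def)
  have hB: "h B = 0" by (simp add: h_def N_def inner_complex_def algebra_simps)
  have h_line: "h X = 0" if "X \<in> affine hull {A, B}" for X
    using that by (auto simp: affine_hull_2 h_affine hA hB)
  have hC: "h C \<noteq> 0"
  proof
    assume "h C = 0"
    moreover have "N \<noteq> 0" using assms(1) by (auto simp: N_def)
    ultimately obtain s where "C - A = s *\<^sub>R (\<i> * N)"
      using orthogonal_imp_multiple_of_normal[of N "C - A"] by (auto simp: h_def inner_commute)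
    then have "C = A + (- s) *\<^sub>R (B - A)" by (simp add: N_def algebra_simps)
    then have "C \<in> affine hull {A, B}" unfolding affine_hull_2_alt by blast
    then have "{A, B, C} \<subseteq> affine hull {A, B}" using vertices_on_side_lines by blast
    then show False using assms(1) collinear_affine_hull by blast
  qed
  have height: "\<exists>w > 0. h Z = w * h C"
    if hull: "Z \<in> convex hull {A, B, C}" and tan: "tangent_at (affine hull {A, B}) Z \<rho> T" for Z \<rho> T
  proof -
    obtain u v w where Z: "w \<ge> 0" "u + v + w = 1" "Z = u *\<^sub>R A + v *\<^sub>R B + w *\<^sub>R C"
      using hull unfolding convex_hull_3 by blast
    have "w \<noteq> 0"
    proof
      assume "w = 0"
      then have "Z \<in> affine hull {A, B}" using Z by (auto simp: affine_hull_2)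
      then have "(dist Z Z)\<^sup>2 = \<rho>\<^sup>2 + (dist Z T)\<^sup>2" using tangent_length[OF tan] by blast
      then show False using tangent_at_radius(3)[OF tan] by (simp add: add_nonneg_eq_0_iff)
    qed
    moreover have "h Z = w * h C"
    proof -
      have "Z - A = v *\<^sub>R (B - A) + w *\<^sub>R (C - A)"
      proof -
        have u: "u = 1 - v - w" using Z(2) by simp
        show ?thesis unfolding Z(3) u by (simp add: algebra_simps)
      qed
      then show ?thesis using hB by (simp add: h_def inner_add_right)
    qed
    ultimately show ?thesis using Z(1) by (intro exI[of _ w]) simp
  qed
  obtain w\<^sub>1 where w\<^sub>1: "w\<^sub>1 > 0" "h Z\<^sub>1 = w\<^sub>1 * h C" using height[OF assms(2,4)] by blast
  obtain w\<^sub>2 where w\<^sub>2: "w\<^sub>2 > 0" "h Z\<^sub>2 = w\<^sub>2 * h C" using height[OF assms(3,5)] by blast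
  have "h X \<noteq> 0" if X: "X \<in> closed_segment Z\<^sub>1 Z\<^sub>2" for X
  proof -
    obtain m where m: "0 \<le> m" "m \<le> 1" "X = (1 - m) *\<^sub>R Z\<^sub>1 + m *\<^sub>R Z\<^sub>2"
      using X by (auto simp: in_segment)
    have "h X = ((1 - m) * w\<^sub>1 + m * w\<^sub>2) * h C"
      unfolding m(3) by (subst h_affine) (simp_all add: w\<^sub>1 w\<^sub>2 distrib_right)
    moreover have "(1 - m) * w\<^sub>1 + m * w\<^sub>2 > 0"
      using convex_bound_lt[of "- w\<^sub>1" 0 "- w\<^sub>2" "1 - m" m] m w\<^sub>1 w\<^sub>2 by simp
    ultimately show ?thesis using hC by simp
  qed
  then show ?thesis using h_line unfolding same_side_def by blast
qed

text \<open>
  It suffices to measure the tangent \<open>AB\<close>, because its length already determines that of every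
  other common external tangent.
\<close>

lemma external_tangent_lengths_of_triad:
  fixes A B C I Z\<^sub>a Z\<^sub>b :: complex
  assumes noncoll: "\<not> collinear {A, B, C}" and inc: "incircle A B C I r"
    and \<theta>: "0 < \<theta>" "\<theta> < 2 * pi"
    and triad: "triad_circle A B C \<theta> Z\<^sub>a \<rho>\<^sub>a" "triad_circle B C A \<theta> Z\<^sub>b \<rho>\<^sub>b"
  shows "external_tangent_lengths Z\<^sub>a \<rho>\<^sub>a Z\<^sub>b \<rho>\<^sub>b = {2 * r * tan (\<theta> / 4)}"
proof -
  let ?t = "tan (\<theta> / 4)"
  obtain P where P: "P \<in> closed_segment A B" "tangent_at (affine hull {A, B}) Z\<^sub>a \<rho>\<^sub>a P"
    "dist A P = (dist C A + dist A B - dist B C) / 2 - r * ?t"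
    using triad_circle_contact[OF noncoll inc \<theta> triad(1)] by metis
  have noncoll': "\<not> collinear {B, C, A}" using noncoll by (simp add: insert_commute)
  obtain Q where Q: "Q \<in> closed_segment B A" "tangent_at (affine hull {B, A}) Z\<^sub>b \<rho>\<^sub>b Q"
    "dist B Q = (dist A B + dist B C - dist C A) / 2 - r * ?t"
    using triad_circle_contact[OF noncoll' incircle_rotate[OF inc] \<theta> triad(2)] by metis
  have Q': "tangent_at (affine hull {A, B}) Z\<^sub>b \<rho>\<^sub>b Q" using Q(2) by (simp add: insert_commute)
  have rt: "r * ?t > 0"
    using incircle_inradius(1)[OF noncoll inc] tan_gt_zero[of "\<theta> / 4"] \<theta> by simp
  have PQ: "dist P Q = 2 * r * ?t"
  proof -
    have AB: "A \<noteq> B" using noncoll by auto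
    obtain k where k: "0 \<le> k" "P = A + k *\<^sub>R (B - A)"
      using P(1) by (auto simp: in_segment algebra_simps)
    obtain l where l: "0 \<le> l" "Q = B - l *\<^sub>R (B - A)"
      using Q(1) by (auto simp: in_segment algebra_simps)
    have kl: "dist A P = k * dist A B" "dist B Q = l * dist A B"
      using k l by (simp_all add: dist_norm norm_minus_commute)
    have "Q - P = (1 - k - l) *\<^sub>R (B - A)" by (simp add: k l algebra_simps)
    then have "dist Q P = \<bar>1 - k - l\<bar> * dist B A" by (simp add: dist_norm)
    then have "dist P Q = \<bar>1 - k - l\<bar> * dist A B" by (simp add: dist_commute)
    also have "\<dots> = \<bar>(1 - k - l) * dist A B\<bar>" by (simp add: abs_mult)
    also have "(1 - k - l) * dist A B = 2 * r * ?t"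
      using kl P(3) Q(3) by (simp add: algebra_simps)
    finally show ?thesis using rt by simp
  qed
  have hull: "Z\<^sub>a \<in> convex hull {A, B, C}" "Z\<^sub>b \<in> convex hull {A, B, C}"
    using triad tangent_at_radius(3)[OF P(2)] tangent_at_radius(3)[OF Q(2)]
    by (auto simp: triad_circle_def insert_commute subset_iff)
  have AB: "common_external_tangent (affine hull {A, B}) Z\<^sub>a \<rho>\<^sub>a P Z\<^sub>b \<rho>\<^sub>b Q"
    using P(2) Q' tangent_circles_in_triangle_same_side[OF noncoll hull P(2) Q']
    by (simp add: common_external_tangent_def)
  have "dist P' Q' = dist P Q" if "common_external_tangent L Z\<^sub>a \<rho>\<^sub>a P' Z\<^sub>b \<rho>\<^sub>b Q'" for L P' Q'
    using external_tangent_length[OF that] external_tangent_length[OF AB]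
    by (simp add: power2_eq_imp_eq)
  then have "d \<in> external_tangent_lengths Z\<^sub>a \<rho>\<^sub>a Z\<^sub>b \<rho>\<^sub>b \<longleftrightarrow> d = dist P Q" for d
    unfolding external_tangent_lengths_def mem_Collect_eq using AB by metis
  then show ?thesis unfolding PQ by blast
qed

theorem theorem6p1:
  fixes A B C I Z\<^sub>a Z\<^sub>b Z\<^sub>c :: complex
    and r \<theta> \<rho>\<^sub>a \<rho>\<^sub>b \<rho>\<^sub>c :: real
  assumes triangle: "\<not> collinear {A, B, C}"
    and inradius: "incircle A B C I r"
    and theta: "0 < \<theta>" "\<theta> < 2 * pi"
    and angles: "vertex_angle B A C < pi - \<theta> / 2"
      "vertex_angle C B A < pi - \<theta> / 2"
      "vertex_angle A C B < pi - \<theta> / 2"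
    and triad: "triad_circle A B C \<theta> Z\<^sub>a \<rho>\<^sub>a"
      "triad_circle B C A \<theta> Z\<^sub>b \<rho>\<^sub>b"
      "triad_circle C A B \<theta> Z\<^sub>c \<rho>\<^sub>c"
  shows "external_tangent_lengths Z\<^sub>a \<rho>\<^sub>a Z\<^sub>b \<rho>\<^sub>b = {2 * r * tan (\<theta> / 4)}
       \<and> external_tangent_lengths Z\<^sub>b \<rho>\<^sub>b Z\<^sub>c \<rho>\<^sub>c = {2 * r * tan (\<theta> / 4)}
       \<and> external_tangent_lengths Z\<^sub>c \<rho>\<^sub>c Z\<^sub>a \<rho>\<^sub>a = {2 * r * tan (\<theta> / 4)}"
proof -
  have "\<not> collinear {B, C, A}" "\<not> collinear {C, A, B}"
    using triangle by (simp_all add: insert_commute)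
  then show ?thesis
    using external_tangent_lengths_of_triad[OF triangle inradius theta triad(1,2)]
      external_tangent_lengths_of_triad[OF _ incircle_rotate[OF inradius] theta triad(2,3)]
      external_tangent_lengths_of_triad[OF _ incircle_rotate[OF incircle_rotate[OF inradius]]
        theta triad(3,1)]
    by blast
qed

end
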